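(* Let $f:\Sigma_N\to\Sigma_N$ be a surjective one-dimensional cellular automaton on $N$ symbols and let $\epsilon>0$. Then there is an invertible one-dimensional cellular automaton $\phi:\Sigma_N\to\Sigma_N$ such that $\nu(\phi f,S_N)>N-\epsilon$, where $\phi f$ denotes the composition $(\phi f)(x)=\phi(f(x))$.
   Context: $\Sigma_N=\mathcal A^{\mathbb Z}$ is the set of doubly infinite sequences over the alphabet $\mathcal A=\{0,1,\dots,N-1\}$, with the product of discrete topologies. The shift map $S_N:\Sigma_N\to\Sigma_N$ is $(S_N x)_i=x_{i+1}$. A one-dimensional cellular automaton (c.a.) on $N$ symbols is a map $f:\Sigma_N\to\Sigma_N$ for which there are integers $a\le b$ and a function $F:\mathcal A^{b-a+1}\to\mathcal A$ such that $(f(x))_i=F(x_{i+a}\cdots x_{i+b})$ for all $x\in\Sigma_N$ and all $i\in\mathbb Z$; equivalently, $f$ is continuous and commutes with $S_N$. A c.a. is invertible if it is a bijection (its inverse is then also a c.a.). For $k\ge 1$, $P_k(S_N)$ denotes the set of points $x\in\Sigma_N$ with $S_N^k x=x$ (period $k$, not necessarily least). This finite set is mapped into itself by any c.a. For a c.a. $g$, a point is periodic under $g$ if $g^n(x)=x$ for some $n\ge1$. Define $$\nu_k(g,S_N)=\big|\{x\in P_k(S_N): x \text{ is periodic under } g\}\big|^{1/k},\qquad \nu(g,S_N)=\limsup_{k\to\infty}\nu_k(g,S_N).$$ *)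

theory Defs
  imports "HOL-Library.Extended_Real" "HOL-Library.Cardinality"
begin

text \<open>
  The alphabet is a type \<open>'a\<close> of class \<open>finite\<close>, with \<open>N = CARD('a) \<ge> 1\<close> symbols, and the full
  shift on \<open>N\<close> symbols is the whole type \<open>int \<Rightarrow> 'a\<close>.
\<close>

definition shift :: "(int \<Rightarrow> 'a) \<Rightarrow> (int \<Rightarrow> 'a)" where
  "shift x = (\<lambda>i. x (i + 1))"

text \<open>
  The local rule \<open>F\<close> is only ever applied to words of length \<open>b - a + 1\<close>; its values on lists of
  other lengths are irrelevant.
\<close>

definition cellular_automaton :: "((int \<Rightarrow> 'a) \<Rightarrow> (int \<Rightarrow> 'a)) \<Rightarrow> bool" where
  "cellular_automaton f \<longleftrightarrow>
    (\<exists>(a::int) (b::int) (F :: 'a list \<Rightarrow> 'a). a \<le> b \<and>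
      (\<forall>x i. f x i = F (map (\<lambda>j. x (i + j)) [a..b])))"

definition invertible_ca :: "((int \<Rightarrow> 'a) \<Rightarrow> (int \<Rightarrow> 'a)) \<Rightarrow> bool" where
  "invertible_ca f \<longleftrightarrow> cellular_automaton f \<and> bij f"

definition period_points :: "nat \<Rightarrow> ('x \<Rightarrow> 'x) \<Rightarrow> 'x set" where
  "period_points k S = {x. (S ^^ k) x = x}"

definition periodic_under :: "('x \<Rightarrow> 'x) \<Rightarrow> 'x \<Rightarrow> bool" where
  "periodic_under g x \<longleftrightarrow> (\<exists>n\<ge>1. (g ^^ n) x = x)"

definition nu_k :: "nat \<Rightarrow> ('x \<Rightarrow> 'x) \<Rightarrow> ('x \<Rightarrow> 'x) \<Rightarrow> real" where
  "nu_k k g S = root k (real (card {x \<in> period_points k S. periodic_under g x}))"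

text \<open>
  The limit superior is taken in \<^typ>\<open>ereal\<close>, so that it is a genuine limit superior without any
  boundedness side condition. Only \<open>k \<ge> 1\<close> is meaningful in \<open>nu_k\<close>; the junk value at \<open>k = 0\<close>
  does not affect the limit superior.
\<close>

definition nu :: "('x \<Rightarrow> 'x) \<Rightarrow> ('x \<Rightarrow> 'x) \<Rightarrow> ereal" where
  "nu g S = limsup (\<lambda>k. ereal (nu_k k g S))"

end

theory Submission
  imports Defs "HOL-Library.FuncSet" "HOL-Combinatorics.Transposition" "HOL-Real_Asymp.Real_Asymp"
begin

text \<open>
  It suffices to find an invertible cellular automaton \<open>\<phi>\<close> such that \<open>\<phi> \<circ> f\<close> fixes
  every point of some set that has, for some \<open>L\<close> and all \<open>k\<close>, at
  least \<open>N powr ((1 - \<delta>) * k * L)\<close> points of period \<open>k * L\<close>, where \<open>\<delta>\<close> is small. So \<open>f\<close>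
  has to be undone by an invertible automaton on a set of nearly full entropy.

  A surjective automaton is pre-injective: points that differ in finitely many places have different
  images (\<open>surj_imp_preinjective\<close>). Hence words of free symbols, placed in a background of a
  constant symbol \<open>z\<close> that \<open>f\<close> preserves, are mapped injectively to longer words in the same
  background. If the words are separated by long runs of \<open>z\<close>, then their images do not
  interact, and \<open>f\<close> acts on the words one by one. The task is to invert this finite injection
  by an automaton that is invertible on the whole full shift.

  For this the runs of \<open>z\<close> serve as markers. In the points considered (\<open>skeleton\<close>), runs of
  length at least \<open>T\<close> occur once per period \<open>L\<close>. Shorter runs are enforced elsewhere by placing, in
  every stretch of length \<open>T\<close>, an isolated symbol \<open>a\<close> that is padded by \<open>r\<close> symbols
  \<open>z\<close>, where \<open>r\<close> is the radius of \<open>f\<close>. By pre-injectivity, the image of an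
  isolated \<open>a\<close> is not the background, so the images of these points have no other long runs
  either. After a shift and an exchange of two symbols (\<open>normalize_ca\<close>), the long
  runs of \<open>x\<close> and \<open>f x\<close> start at the same positions. Any permutation of the words of length \<open>L\<close>
  that can stand between two markers at distance \<open>L\<close> defines an invertible automaton, because
  such replacements neither create nor destroy markers (\<open>marker_recode\<close>,
  \<open>invertible_recode\<close>). A permutation that extends the inverse of the action of \<open>f\<close> on
  words gives the required automaton (\<open>left_inverse_on_skeleton\<close>).

  The separators and the runs take up a vanishing proportion of the period when the number of
  free symbols per stretch and the number of stretches per period grow.
\<close>

section \<open>Cellular automata by radius\<close>

text \<open>
  Locality and commutation with the shift in one condition: the value at a position depends only
  on the pattern seen within distance \<open>r\<close>, and not on the position itself.
\<close>

definition has_radius :: "int \<Rightarrow> ((int \<Rightarrow> 'a) \<Rightarrow> (int \<Rightarrow> 'a)) \<Rightarrow> bool" where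
  "has_radius r f \<longleftrightarrow> 0 \<le> r \<and>
    (\<forall>x y i j. (\<forall>t. \<bar>t\<bar> \<le> r \<longrightarrow> x (i + t) = y (j + t)) \<longrightarrow> f x i = f y j)"

lemma has_radiusD:
  assumes "has_radius r f" "\<And>t. \<bar>t\<bar> \<le> r \<Longrightarrow> x (i + t) = y (j + t)"
  shows "f x i = f y j"
  using assms unfolding has_radius_def by blast

lemma has_radius_nonneg: "has_radius r f \<Longrightarrow> 0 \<le> r"
  by (simp add: has_radius_def)

lemma cellular_automaton_iff_has_radius:
  "cellular_automaton f \<longleftrightarrow> (\<exists>r. has_radius r f)"
proof
  assume "cellular_automaton f"
  then obtain a b F where ab: "a \<le> b" and F: "\<And>x i. f x i = F (map (\<lambda>j. x (i + j)) [a..b])"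
    unfolding cellular_automaton_def by blast
  have "has_radius (max \<bar>a\<bar> \<bar>b\<bar>) f"
    unfolding has_radius_def
  proof (intro conjI allI impI)
    fix x y :: "int \<Rightarrow> 'a" and i j
    assume "\<forall>t. \<bar>t\<bar> \<le> max \<bar>a\<bar> \<bar>b\<bar> \<longrightarrow> x (i + t) = y (j + t)"
    then have "map (\<lambda>t. x (i + t)) [a..b] = map (\<lambda>t. y (j + t)) [a..b]"
      by auto
    then show "f x i = f y j"
      by (simp only: F)
  qed auto
  then show "\<exists>r. has_radius r f" ..
next
  assume "\<exists>r. has_radius r f"
  then obtain r where r: "has_radius r f" ..
  define F where "F w = f (\<lambda>j. w ! nat (j + r)) 0" for w
  have "f x i = F (map (\<lambda>j. x (i + j)) [-r..r])" for x i
    unfolding F_def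
  proof (rule has_radiusD[OF r])
    fix t :: int assume "\<bar>t\<bar> \<le> r"
    then show "x (i + t) = map (\<lambda>j. x (i + j)) [- r..r] ! nat (0 + t + r)"
      by (simp add: nth_map abs_le_iff)
  qed
  then show "cellular_automaton f"
    unfolding cellular_automaton_def using has_radius_nonneg[OF r]
    by (intro exI[of _ "-r"] exI[of _ r] exI[of _ F]) auto
qed

lemma has_radius_comp:
  assumes "has_radius r f" "has_radius s g"
  shows "has_radius (r + s) (g \<circ> f)"
  unfolding has_radius_def
proof (intro conjI allI impI)
  show "0 \<le> r + s"
    using assms by (simp add: has_radius_def)
  fix x y :: "int \<Rightarrow> 'a" and i j
  assume *: "\<forall>t. \<bar>t\<bar> \<le> r + s \<longrightarrow> x (i + t) = y (j + t)"
  have "g (f x) i = g (f y) j"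
  proof (rule has_radiusD[OF assms(2)])
    fix t :: int assume t: "\<bar>t\<bar> \<le> s"
    show "f x (i + t) = f y (j + t)"
    proof (rule has_radiusD[OF assms(1)])
      fix u :: int assume "\<bar>u\<bar> \<le> r"
      then have "\<bar>t + u\<bar> \<le> r + s"
        using t by linarith
      then show "x (i + t + u) = y (j + t + u)"
        using * by (simp add: add.assoc)
    qed
  qed
  then show "(g \<circ> f) x i = (g \<circ> f) y j"
    by simp
qed

lemma invertible_ca_comp:
  assumes "invertible_ca f" "invertible_ca g"
  shows "invertible_ca (g \<circ> f)"
  using assms has_radius_comp bij_comp
  unfolding invertible_ca_def cellular_automaton_iff_has_radius by blast

definition word :: "int \<Rightarrow> (int \<Rightarrow> 'a) \<Rightarrow> int \<Rightarrow> 'a list" where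
  "word n x j = map (\<lambda>t. x (j + t)) [0..n - 1]"

lemma length_word [simp]: "length (word n x j) = nat n"
  by (simp add: word_def)

lemma word_nth: "0 \<le> t \<Longrightarrow> t < n \<Longrightarrow> word n x j ! nat t = x (j + t)"
  by (simp add: word_def)

lemma word_eq_iff: "word n x i = word n y j \<longleftrightarrow> (\<forall>t. 0 \<le> t \<and> t < n \<longrightarrow> x (i + t) = y (j + t))"
  by (auto simp: word_def)

lemma finite_words: "finite {w :: 'a::finite list. length w = n}"
  using finite_lists_length_eq[of "UNIV :: 'a set" n] by simp

lemma card_words: "card {w :: 'a::finite list. length w = n} = CARD('a) ^ n"
  using card_lists_length_eq[of "UNIV :: 'a set" n] by simp

section \<open>Surjective cellular automata are pre-injective\<close>

text \<open>
  Two finitely different points with the same image can be exchanged inside any other point: a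
  window of length \<open>2 * r + 1\<close> that meets the differing part lies in the padded occurrence, where
  it reads the same as in \<open>x\<close> or \<open>x'\<close>.
\<close>

lemma replace_twin:
  assumes f: "has_radius r f"
    and eq: "f x = f x'" and out: "\<And>i. \<not> (A \<le> i \<and> i < B) \<Longrightarrow> x i = x' i"
    and occ: "\<And>t. A - 2 * r \<le> t \<Longrightarrow> t < B + 2 * r \<Longrightarrow> y (s + t) = x' t"
  shows "f (\<lambda>i. if A \<le> i - s \<and> i - s < B then x (i - s) else y i) = f y"
    (is "f ?y = _")
proof
  fix i
  show "f ?y i = f y i"
  proof (cases "A - r \<le> i - s \<and> i - s < B + r")
    case True
    have occ': "y (i + t) = x' (i - s + t)" if "\<bar>t\<bar> \<le> r" for t
      using occ[of "i - s + t"] that True by (simp add: abs_le_iff)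
    have "f ?y i = f x (i - s)"
    proof (rule has_radiusD[OF f])
      fix t :: int assume t: "\<bar>t\<bar> \<le> r"
      show "?y (i + t) = x (i - s + t)"
        using occ'[OF t] out[of "i - s + t"] by (auto simp: algebra_simps)
    qed
    also have "\<dots> = f x' (i - s)"
      by (simp add: eq)
    also have "\<dots> = f y i"
      by (rule has_radiusD[OF f]) (simp add: occ')
    finally show ?thesis .
  next
    case False
    show ?thesis
      by (rule has_radiusD[OF f]) (use False in auto)
  qed
qed

text \<open>
  Exchanging the twins block by block, from left to right, removes one padded word from all aligned
  blocks without changing the image. The exchange in block \<open>m\<close> leaves the other blocks
  alone because only the inner part of an occurrence is altered.
\<close>

lemma avoid_twin:
  fixes m :: nat
  assumes f: "has_radius r f"
    and eq: "f x = f x'" and out: "\<And>i. \<not> (A \<le> i \<and> i < B) \<Longrightarrow> x i = x' i" and ne: "x \<noteq> x'"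
    and n: "n = B - A + 4 * r"
  shows "\<exists>y'. f y' = f y \<and> (\<forall>k<m. word n y' (int k * n) \<noteq> word n x' (A - 2 * r))"
proof (induction m)
  case 0
  then show ?case by auto
next
  case (Suc m)
  then obtain y' where y': "f y' = f y" "\<And>k. k < m \<Longrightarrow> word n y' (int k * n) \<noteq> word n x' (A - 2 * r)"
    by auto
  show ?case
  proof (cases "word n y' (int m * n) = word n x' (A - 2 * r)")
    case False
    with y' show ?thesis by (metis less_Suc_eq)
  next
    case True
    \<comment> \<open>Translation by \<open>s\<close> carries the padded window of the twins to block \<open>m\<close>.\<close>
    define s where "s = int m * n - (A - 2 * r)"
    define z where "z = (\<lambda>i. if A \<le> i - s \<and> i - s < B then x (i - s) else y' i)"
    have r: "0 \<le> r" using f by (rule has_radius_nonneg)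
    obtain c where c: "x c \<noteq> x' c" "A \<le> c" "c < B"
      using ne out by (metis ext)
    have "f z = f y'"
      unfolding z_def
    proof (rule replace_twin[OF f eq out])
      fix t assume "A - 2 * r \<le> t" "t < B + 2 * r"
      then show "y' (s + t) = x' t"
        using True[unfolded word_eq_iff, rule_format, of "t - (A - 2 * r)"]
        by (simp add: n s_def algebra_simps)
    qed
    moreover have "word n z (int k * n) \<noteq> word n x' (A - 2 * r)" if "k < Suc m" for k
    proof (cases "k = m")
      case True
      have "z (int m * n + (c - (A - 2 * r))) = x c"
        using c r by (simp add: z_def s_def)
      then show ?thesis
        using c r True by (force simp: word_eq_iff n intro!: exI[of _ "c - (A - 2 * r)"])
    next
      case False
      then have "k < m" using that by simp
      have "word n z (int k * n) = word n y' (int k * n)"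
        unfolding word_eq_iff
      proof (intro allI impI)
        fix t assume t: "0 \<le> t \<and> t < n"
        have "int k * n + n \<le> int m * n"
          using \<open>k < m\<close> t mult_right_mono[of "int k + 1" "int m" n] by (simp add: algebra_simps)
        then show "z (int k * n + t) = y' (int k * n + t)"
          using t r by (simp add: z_def s_def)
      qed
      with y'(2)[OF \<open>k < m\<close>] show ?thesis by simp
    qed
    ultimately show ?thesis
      using y'(1) by metis
  qed
qed

text \<open>
  If one word may be excluded from the blocks without losing images, then the patterns that the
  image shows on \<open>m\<close> blocks, up to \<open>r\<close> symbols at either end, are determined by one of
  \<open>(N ^ n - 1) ^ m\<close> patterns.
\<close>

lemma restricted_blocks_bound:
  fixes f :: "(int \<Rightarrow> 'a::finite) \<Rightarrow> (int \<Rightarrow> 'a)"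
  assumes f: "has_radius r f" and n: "0 < n"
    and u: "length u = nat n"
    and hit: "\<And>y. \<exists>x. f x = y \<and> (\<forall>k<m. word n x (int k * n) \<noteq> u)"
  shows "CARD('a) ^ (m * nat n) \<le> CARD('a) ^ nat (2 * r) * (CARD('a) ^ nat n - 1) ^ m"
proof -
  have r: "0 \<le> r" using f by (rule has_radius_nonneg)
  define I where "I = {r..<int m * n - r}"
  define P where "P = (PiE I (\<lambda>_. UNIV :: 'a set))"
  define Q where "Q = (PiE {..<m} (\<lambda>_. {w :: 'a list. length w = nat n} - {u}))"
  obtain g where g: "\<And>y. f (g y) = y" "\<And>y k. k < m \<Longrightarrow> word n (g y) (int k * n) \<noteq> u"
    using hit by metis
  define h where "h y = (\<lambda>k\<in>{..<m}. word n (g y) (int k * n))" for y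
  have "inj_on h P"
  proof (rule inj_onI)
    fix y y' assume yy: "y \<in> P" "y' \<in> P" and "h y = h y'"
    then have eq: "word n (g y) (int k * n) = word n (g y') (int k * n)" if "k < m" for k
      using that by (metis h_def lessThan_iff restrict_apply')
    have ag: "g y i = g y' i" if i: "0 \<le> i" "i < int m * n" for i
    proof -
      have "i div n * n < int m * n"
        using i n pos_mod_sign[of n i] div_mult_mod_eq[of i n] by linarith
      then have d: "i div n < int m" "0 \<le> i div n"
        using i n by (simp_all add: pos_imp_zdiv_nonneg_iff)
      then have "word n (g y) (i div n * n) = word n (g y') (i div n * n)"
        using eq[of "nat (i div n)"] by (simp add: nat_less_iff)
      then have "g y (i div n * n + i mod n) = g y' (i div n * n + i mod n)"
        unfolding word_eq_iff using n pos_mod_sign[of n i] pos_mod_bound[of n i] by blast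
      then show ?thesis by simp
    qed
    show "y = y'"
    proof
      fix i
      show "y i = y' i"
      proof (cases "i \<in> I")
        case True
        have "f (g y) i = f (g y') i"
          by (rule has_radiusD[OF f], rule ag) (use True in \<open>auto simp: I_def abs_le_iff\<close>)
        then show ?thesis by (simp add: g)
      next
        case False
        then show ?thesis using yy by (auto simp: P_def PiE_def extensional_def)
      qed
    qed
  qed
  moreover have "h ` P \<subseteq> Q"
    using g(2) by (simp add: h_def Q_def image_subset_iff restrict_PiE_iff)
  moreover have "finite Q"
    by (auto simp: Q_def finite_words intro!: finite_PiE)
  ultimately have le: "card P \<le> card Q"
    by (rule card_inj_on_le)
  have "card ({w :: 'a list. length w = nat n} - {u}) = CARD('a) ^ nat n - 1"
    using u by (simp add: card_words finite_words)
  then have cQ: "card Q = (CARD('a) ^ nat n - 1) ^ m"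
    unfolding Q_def by (subst card_PiE) auto
  have cP: "card P = CARD('a) ^ nat (int m * n - 2 * r)"
    unfolding P_def I_def by (subst card_PiE) (auto simp: algebra_simps)
  have "m * nat n \<le> nat (2 * r) + nat (int m * n - 2 * r)"
    using n r by (simp add: nat_mult_distrib flip: nat_add_distrib zle_int)
  then have "CARD('a) ^ (m * nat n) \<le> CARD('a) ^ (nat (2 * r) + nat (int m * n - 2 * r))"
    by (intro power_increasing) (simp_all add: Suc_leI)
  also have "\<dots> = CARD('a) ^ nat (2 * r) * card P"
    by (simp add: power_add cP)
  also have "\<dots> \<le> CARD('a) ^ nat (2 * r) * card Q"
    using le by simp
  finally show ?thesis by (simp add: cQ)
qed

text \<open>
  This is the one-dimensional case of Moore's Garden of Eden theorem. A pair of distinct twins would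
  let every image pattern come from blocks avoiding a fixed word, and the boundary factor
  \<open>N ^ (2 * r)\<close> cannot make up for the exponential loss \<open>((N ^ n - 1) / N ^ n) ^ m\<close>.
\<close>

theorem surj_imp_preinjective:
  fixes f :: "(int \<Rightarrow> 'a::finite) \<Rightarrow> (int \<Rightarrow> 'a)"
  assumes f: "has_radius r f" and "surj f"
    and eq: "f x = f x'" and out: "\<And>i. \<not> (A \<le> i \<and> i < B) \<Longrightarrow> x i = x' i"
  shows "x = x'"
proof (rule ccontr)
  assume ne: "x \<noteq> x'"
  have r: "0 \<le> r" using f by (rule has_radius_nonneg)
  define n where "n = B - A + 4 * r"
  obtain c where c: "x c \<noteq> x' c" "A \<le> c" "c < B"
    using ne out by (metis ext)
  have n: "0 < n" using c r by (simp add: n_def)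
  define N where "N = real CARD('a)"
  define q where "q = (N ^ nat n - 1) / N ^ nat n"
  have N: "N \<ge> 1" by (simp add: N_def Suc_leI)
  have bound: "1 \<le> N ^ nat (2 * r) * q ^ m" for m
  proof -
    have "CARD('a) ^ (m * nat n) \<le> CARD('a) ^ nat (2 * r) * (CARD('a) ^ nat n - 1) ^ m"
    proof (rule restricted_blocks_bound[OF f n])
      show "\<exists>v. f v = y \<and> (\<forall>k<m. word n v (int k * n) \<noteq> word n x' (A - 2 * r))" for y
      proof -
        obtain v where "f v = y" using \<open>surj f\<close> by (metis surjD)
        then show ?thesis
          using avoid_twin[OF f eq out ne n_def, where m = m and y = v] by simp
      qed
    qed simp
    then have "real (CARD('a) ^ (m * nat n)) \<le> real (CARD('a) ^ nat (2 * r) * (CARD('a) ^ nat n - 1) ^ m)"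
      by (simp only: of_nat_le_iff)
    then have "(N ^ nat n) ^ m \<le> N ^ nat (2 * r) * (N ^ nat n - 1) ^ m"
      by (simp add: N_def of_nat_diff Suc_leI mult.commute flip: power_mult)
    then show ?thesis
      using N by (simp add: q_def power_divide field_simps)
  qed
  have "0 \<le> q" "q < 1"
    using N by (simp_all add: q_def)
  then have "(\<lambda>m. N ^ nat (2 * r) * q ^ m) \<longlonglongrightarrow> N ^ nat (2 * r) * 0"
    by (intro tendsto_intros LIMSEQ_realpow_zero)
  then have "1 \<le> N ^ nat (2 * r) * 0"
    by (rule LIMSEQ_le_const) (use bound in blast)
  then show False by simp
qed

text \<open>
  Pre-injectivity localized: transplanting the stretch of \<open>x'\<close> between the two agreeing
  margins into \<open>x\<close> gives a point that differs from \<open>x\<close> in finitely many places and has the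
  same image.
\<close>

lemma no_diamond:
  fixes f :: "(int \<Rightarrow> 'a::finite) \<Rightarrow> (int \<Rightarrow> 'a)"
  assumes f: "has_radius r f" "surj f"
    and left: "\<And>i. A - 2 * r \<le> i \<Longrightarrow> i < A \<Longrightarrow> x i = x' i"
    and right: "\<And>i. B \<le> i \<Longrightarrow> i < B + 2 * r \<Longrightarrow> x i = x' i"
    and eq: "\<And>i. A - r \<le> i \<Longrightarrow> i < B + r \<Longrightarrow> f x i = f x' i"
    and i: "A \<le> i" "i < B"
  shows "x i = x' i"
proof -
  define y where "y = (\<lambda>i. if A \<le> i \<and> i < B then x' i else x i)"
  have yx: "y i = x' i" if "A - 2 * r \<le> i" "i < B + 2 * r" for i
    using that left right by (auto simp: y_def not_le not_less)
  have "f y = f x"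
  proof
    fix i
    show "f y i = f x i"
    proof (cases "A - r \<le> i \<and> i < B + r")
      case True
      have "f y i = f x' i"
        by (rule has_radiusD[OF f(1)]) (use True in \<open>auto intro!: yx\<close>)
      with True eq show ?thesis by simp
    next
      case False
      show ?thesis
        by (rule has_radiusD[OF f(1)]) (use False in \<open>auto simp: y_def\<close>)
    qed
  qed
  then have "y = x"
    by (rule surj_imp_preinjective[OF f, where A = A and B = B]) (auto simp: y_def)
  then show ?thesis
    using i by (auto simp: y_def dest: fun_cong[of _ _ i])
qed

section \<open>Permuting the words between markers\<close>

text \<open>
  A marker is the start of a run of at least \<open>T\<close> symbols \<open>z\<close>. The symbol before it
  must differ from \<open>z\<close>, so a longer run still carries a single marker. A site is a
  marker followed by the next one at distance exactly \<open>L\<close>. The recoding applies a permutation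
  of words to the \<open>L\<close> symbols of each site; words at sites end in a symbol other than \<open>z\<close>,
  begin with \<open>T\<close> symbols \<open>z\<close>, and create no marker in between, and so a
  permutation of such words leaves all markers of a point in place.
\<close>

locale marker_blocks =
  fixes z :: 'a and T L :: int
  assumes T: "0 < T" and TL: "T < L"
begin

definition marker :: "(int \<Rightarrow> 'a) \<Rightarrow> int \<Rightarrow> bool" where
  "marker y j \<longleftrightarrow> y (j - 1) \<noteq> z \<and> (\<forall>t. 0 \<le> t \<and> t < T \<longrightarrow> y (j + t) = z)"

definition site :: "(int \<Rightarrow> 'a) \<Rightarrow> int \<Rightarrow> bool" where
  "site y j \<longleftrightarrow> marker y j \<and> marker y (j + L) \<and> (\<forall>t. 0 < t \<and> t < L \<longrightarrow> \<not> marker y (j + t))"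

definition site_words :: "'a list set" where
  "site_words = {word L y j | y j. site y j}"

definition recode :: "('a list \<Rightarrow> 'a list) \<Rightarrow> (int \<Rightarrow> 'a) \<Rightarrow> int \<Rightarrow> 'a" where
  "recode \<pi> y i =
    (if \<exists>t. 0 \<le> t \<and> t < L \<and> site y (i - t)
     then let t = (THE t. 0 \<le> t \<and> t < L \<and> site y (i - t)) in \<pi> (word L y (i - t)) ! nat t
     else y i)"

lemma site_unique:
  assumes "site y j" "site y j'" "j \<le> i" "i < j + L" "j' \<le> i" "i < j' + L"
  shows "j = j'"
proof (rule ccontr)
  assume "j \<noteq> j'"
  then have "0 < j' - j \<and> j' - j < L \<or> 0 < j - j' \<and> j - j' < L"
    using assms by linarith
  then show False
    using assms(1,2) unfolding site_def by (metis add.commute diff_add_cancel)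
qed

lemma recode_inside:
  assumes j: "site y j" "0 \<le> t" "t < L"
  shows "recode \<pi> y (j + t) = \<pi> (word L y j) ! nat t"
proof -
  have "(THE s. 0 \<le> s \<and> s < L \<and> site y (j + t - s)) = t"
  proof (rule the_equality)
    fix s assume "0 \<le> s \<and> s < L \<and> site y (j + t - s)"
    then show "s = t"
      using site_unique[of y j "j + t - s" "j + t"] j by auto
  qed (use j in auto)
  moreover have "\<exists>s. 0 \<le> s \<and> s < L \<and> site y (j + t - s)"
    using j by (intro exI[of _ t]) auto
  ultimately show ?thesis
    by (simp add: recode_def)
qed

lemma recode_outside:
  assumes "\<And>j. site y j \<Longrightarrow> \<not> (j \<le> i \<and> i < j + L)"
  shows "recode \<pi> y i = y i"
proof -
  have "\<not> (\<exists>t. 0 \<le> t \<and> t < L \<and> site y (i - t))"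
    using assms[of "i - t" for t] by force
  then show ?thesis unfolding recode_def by (rule if_not_P)
qed

lemma site_zero: "site y j \<Longrightarrow> 0 \<le> t \<Longrightarrow> t < T \<Longrightarrow> y (j + t) = z"
  by (simp add: site_def marker_def)

lemma site_last: "site y j \<Longrightarrow> y (j + L - 1) \<noteq> z"
  by (simp add: site_def marker_def)

lemma site_words_same_length: "w \<in> site_words \<Longrightarrow> length w = nat L"
  by (auto simp: site_words_def)

context
  fixes \<pi> :: "'a list \<Rightarrow> 'a list"
  assumes \<pi>: "\<And>w. w \<in> site_words \<Longrightarrow> \<pi> w \<in> site_words"
begin

lemma word_recode:
  assumes "site y j"
  shows "word L (recode \<pi> y) j = \<pi> (word L y j)"
proof -
  have "\<pi> (word L y j) \<in> site_words"
    using assms by (intro \<pi>) (auto simp: site_words_def)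
  then have "length (\<pi> (word L y j)) = nat L"
    by (rule site_words_same_length)
  then show ?thesis
    using recode_inside[OF assms] by (intro nth_equalityI) (auto simp: word_def)
qed

text \<open>
  A recoded site looks like a site of some point \<open>v\<close>, and so inherits whatever can be read off
  the \<open>L\<close> symbols of a site.
\<close>

lemma recode_at_site:
  assumes "site y j"
  obtains v j' where "site v j'" "\<And>t. 0 \<le> t \<Longrightarrow> t < L \<Longrightarrow> recode \<pi> y (j + t) = v (j' + t)"
proof -
  have "word L (recode \<pi> y) j \<in> site_words"
    unfolding word_recode[OF assms] by (rule \<pi>) (use assms in \<open>auto simp: site_words_def\<close>)
  then obtain v j' where "site v j'" "word L (recode \<pi> y) j = word L v j'"
    by (auto simp: site_words_def)
  then show ?thesis
    using that by (auto simp: word_eq_iff)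
qed

lemma recode_site_zero:
  assumes "site y j" "0 \<le> t" "t < T"
  shows "recode \<pi> y (j + t) = z"
  using recode_at_site[OF assms(1)] site_zero assms(2,3) TL by (metis less_trans)

lemma recode_site_last:
  assumes "site y j"
  shows "recode \<pi> y (j + L - 1) \<noteq> z"
proof -
  obtain v j' where "site v j'" "\<And>t. 0 \<le> t \<Longrightarrow> t < L \<Longrightarrow> recode \<pi> y (j + t) = v (j' + t)"
    using recode_at_site[OF assms] by blast
  moreover from this(2)[of "L - 1"] have "recode \<pi> y (j + L - 1) = v (j' + L - 1)"
    using T TL by (simp add: add_diff_eq)
  ultimately show ?thesis
    using site_last by simp
qed

lemma recode_site_no_inner_marker:
  assumes j: "site y j" and t: "0 < t" "t < L"
  shows "\<not> marker (recode \<pi> y) (j + t)"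
proof
  assume m: "marker (recode \<pi> y) (j + t)"
  show False
  proof (cases "t + T \<le> L")
    case True
    obtain v j' where v: "site v j'" "\<And>t. 0 \<le> t \<Longrightarrow> t < L \<Longrightarrow> recode \<pi> y (j + t) = v (j' + t)"
      using recode_at_site[OF j] by blast
    have "marker v (j' + t)"
      unfolding marker_def
    proof (intro conjI allI impI)
      show "v (j' + t - 1) \<noteq> z"
        using m v(2)[of "t - 1"] t by (simp add: marker_def algebra_simps)
      fix s assume s: "0 \<le> s \<and> s < T"
      then have "recode \<pi> y (j + t + s) = z"
        using m by (simp add: marker_def)
      then show "v (j' + t + s) = z"
        using v(2)[of "t + s"] t True s by (simp add: add.assoc)
    qed
    then show False
      using v(1) t by (simp add: site_def)
  next
    case False
    have "recode \<pi> y (j + t + (L - 1 - t)) = z"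
    proof -
      have "0 \<le> L - 1 - t \<and> L - 1 - t < T" using False t by auto
      then show ?thesis using m unfolding marker_def by blast
    qed
    then show False
      using recode_site_last[OF j] by (simp add: algebra_simps)
  qed
qed

lemma recode_before_site:
  assumes "marker y i"
  shows "recode \<pi> y (i - 1) \<noteq> z"
proof (cases "\<exists>j. site y j \<and> j \<le> i - 1 \<and> i - 1 < j + L")
  case True
  then obtain j where j: "site y j" "j \<le> i - 1" "i - 1 < j + L" by blast
  have "\<not> (0 < i - j \<and> i - j < L)"
    using j(1) assms unfolding site_def by (metis add.commute diff_add_cancel)
  then have "i = j + L" using j by linarith
  then show ?thesis using recode_site_last[OF j(1)] by simp
next
  case False
  then have "recode \<pi> y (i - 1) = y (i - 1)"
    by (intro recode_outside) blast
  then show ?thesis using assms by (simp add: marker_def)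
qed

text \<open>
  The one delicate case is a position that lies in no site. Its run of \<open>z\<close>, before or
  after recoding, cannot reach into a site on the right, since the symbol just before a site is never
  \<open>z\<close>; so recoding does not touch that run.
\<close>

lemma marker_recode: "marker (recode \<pi> y) i \<longleftrightarrow> marker y i"
proof (cases "\<exists>j. site y j \<and> j \<le> i \<and> i < j + L")
  case True
  then obtain j where j: "site y j" "j \<le> i" "i < j + L" by blast
  show ?thesis
  proof (cases "i = j")
    case True
    then show ?thesis
      using j(1) recode_before_site[of y j] recode_site_zero[OF j(1)] by (auto simp: marker_def site_def)
  next
    case False
    then show ?thesis
      using recode_site_no_inner_marker[OF j(1), of "i - j"] j
      by (auto simp: site_def dest: spec[of _ "i - j"])
  qed
next
  case False
  have same: "recode \<pi> y (i + t) = y (i + t)"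
    if zero: "\<And>s. 0 \<le> s \<Longrightarrow> s < T \<Longrightarrow> x (i + s) = z" and x: "x = y \<or> x = recode \<pi> y"
      and t: "0 \<le> t" "t < T" for x t
  proof (rule recode_outside, rule notI)
    fix j assume j: "site y j" "j \<le> i + t \<and> i + t < j + L"
    have "i < j"
    proof (rule ccontr)
      assume "\<not> i < j"
      then have "site y j \<and> j \<le> i \<and> i < j + L" using j t by auto
      then show False using False by blast
    qed
    then have "x (j - 1) = z"
      using zero[of "j - 1 - i"] j t by simp
    moreover have "y (j - 1) \<noteq> z" "recode \<pi> y (j - 1) \<noteq> z"
      using j(1) recode_before_site[of y j] by (auto simp: site_def marker_def)
    ultimately show False using x by auto
  qed
  show ?thesis
  proof
    assume m: "marker y i"
    then show "marker (recode \<pi> y) i"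
      using same[of y] recode_before_site[OF m] by (auto simp: marker_def)
  next
    assume m: "marker (recode \<pi> y) i"
    show "marker y i"
    proof (cases "\<exists>j. site y j \<and> j \<le> i - 1 \<and> i - 1 < j + L")
      case True
      then obtain j where j: "site y j" "j \<le> i - 1" "i - 1 < j + L" by blast
      then have "\<not> (j \<le> i \<and> i < j + L)" using False by blast
      then have "i = j + L" using j by linarith
      then show ?thesis using j(1) by (simp add: site_def)
    next
      case False
      then have "recode \<pi> y (i - 1) = y (i - 1)"
        by (intro recode_outside) blast
      then show ?thesis
        using m same[of "recode \<pi> y"] by (auto simp: marker_def)
    qed
  qed
qed

lemma site_recode: "site (recode \<pi> y) = site y"
  by (intro ext) (simp add: site_def marker_recode)

end

text \<open>
  The recoded point has the same sites, so a second recoding acts on the same words.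
\<close>

lemma recode_inverse:
  assumes "\<And>w. w \<in> site_words \<Longrightarrow> \<pi> w \<in> site_words"
    and "\<And>w. w \<in> site_words \<Longrightarrow> \<rho> w \<in> site_words"
    and inv: "\<And>w. w \<in> site_words \<Longrightarrow> \<rho> (\<pi> w) = w"
  shows "recode \<rho> (recode \<pi> y) = y"
proof
  fix i
  show "recode \<rho> (recode \<pi> y) i = y i"
  proof (cases "\<exists>j. site y j \<and> j \<le> i \<and> i < j + L")
    case True
    then obtain j where j: "site y j" "j \<le> i" "i < j + L" by blast
    have "word L (recode \<rho> (recode \<pi> y)) j = \<rho> (word L (recode \<pi> y) j)"
      using j assms by (intro word_recode) (simp_all add: site_recode)
    also have "\<dots> = word L y j"
    proof -
      have "word L y j \<in> site_words"
        using j by (auto simp: site_words_def)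
      then show ?thesis
        using j(1) assms(1) by (simp add: word_recode inv)
    qed
    finally show ?thesis
      unfolding word_eq_iff using j by (auto dest: spec[of _ "i - j"])
  next
    case False
    show ?thesis
    proof -
      have out: "\<not> (j \<le> i \<and> i < j + L)" if "site y j" for j
        using False that by blast
      have "recode \<rho> (recode \<pi> y) i = recode \<pi> y i"
        by (rule recode_outside) (use out assms(1) in \<open>simp add: site_recode\<close>)
      also have "\<dots> = y i"
        by (rule recode_outside) (use out in simp)
      finally show ?thesis .
    qed
  qed
qed

lemma bij_recode:
  assumes "bij_betw \<pi> site_words site_words"
  shows "bij (recode \<pi>)"
proof (rule o_bij)
  define \<rho> where "\<rho> = inv_into site_words \<pi>"
  have *: "\<pi> w \<in> site_words" "\<rho> w \<in> site_words" "\<rho> (\<pi> w) = w" "\<pi> (\<rho> w) = w" if "w \<in> site_words" for w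
    using assms that bij_betw_inv_into[OF assms]
    by (auto simp: \<rho>_def bij_betw_inv_into_left bij_betw_inv_into_right bij_betw_apply)
  show "recode \<rho> \<circ> recode \<pi> = id" "recode \<pi> \<circ> recode \<rho> = id"
    using * by (auto simp: fun_eq_iff recode_inverse)
qed

lemma marker_cong:
  assumes "\<And>t. -1 \<le> t \<Longrightarrow> t < T \<Longrightarrow> x (i + t) = y (j + t)"
  shows "marker x i = marker y j"
  using assms[of "-1"] assms T by (simp add: marker_def)

lemma site_cong:
  assumes "\<And>t. -1 \<le> t \<Longrightarrow> t < L + T \<Longrightarrow> x (i + t) = y (j + t)"
  shows "site x i = site y j"
proof -
  have "marker x (i + s) = marker y (j + s)" if "0 \<le> s" "s \<le> L" for s
    using assms[of "s + t" for t] that T by (intro marker_cong) (simp add: add.assoc)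
  from this[of 0] this[of L] this show ?thesis
    using T TL by (auto simp: site_def)
qed

lemma has_radius_recode: "has_radius (2 * L + T) (recode \<pi>)"
  unfolding has_radius_def
proof (intro conjI allI impI)
  show "0 \<le> 2 * L + T" using T TL by simp
  fix x y :: "int \<Rightarrow> 'a" and i j
  assume *: "\<forall>t. \<bar>t\<bar> \<le> 2 * L + T \<longrightarrow> x (i + t) = y (j + t)"
  have eq: "x (i - s + t) = y (j - s + t)" if "0 \<le> s" "s < L" "-1 \<le> t" "t < L + T" for s t
    using *[rule_format, of "t - s"] that T TL by (simp add: algebra_simps abs_le_iff)
  have st: "site x (i - s) = site y (j - s)" if "0 \<le> s" "s < L" for s
    using eq that by (intro site_cong) auto
  show "recode \<pi> x i = recode \<pi> y j"
  proof (cases "\<exists>s. 0 \<le> s \<and> s < L \<and> site x (i - s)")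
    case True
    then obtain s where s: "0 \<le> s" "s < L" "site x (i - s)" by blast
    have "word L x (i - s) = word L y (j - s)"
      using eq s T by (auto simp: word_eq_iff)
    then show ?thesis
      using recode_inside[of x "i - s" s \<pi>] recode_inside[of y "j - s" s \<pi>] s st by simp
  next
    case False
    then have "\<not> (\<exists>s. 0 \<le> s \<and> s < L \<and> site y (j - s))"
      using st by blast
    then show ?thesis
      unfolding recode_def if_not_P[OF False] by (subst if_not_P) (use *[rule_format, of 0] T TL in simp_all)
  qed
qed

lemma invertible_recode:
  assumes "bij_betw \<pi> site_words site_words"
  shows "invertible_ca (recode \<pi>)"
  using bij_recode[OF assms] has_radius_recode
  unfolding invertible_ca_def cellular_automaton_iff_has_radius by blast

end

text \<open>
  The condition says that \<open>u x \<mapsto> v x\<close> is a well-defined injection between subsets of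
  \<open>G\<close>; finiteness leaves equally many points to match outside.
\<close>

lemma extend_matching:
  assumes "finite G" "u ` X \<subseteq> G" "v ` X \<subseteq> G"
    and uv: "\<And>x y. x \<in> X \<Longrightarrow> y \<in> X \<Longrightarrow> u x = u y \<longleftrightarrow> v x = v y"
  shows "\<exists>\<pi>. bij_betw \<pi> G G \<and> (\<forall>x\<in>X. \<pi> (u x) = v x)"
proof -
  define \<sigma> where "\<sigma> w = v (SOME x. x \<in> X \<and> u x = w)" for w
  have \<sigma>: "\<sigma> (u x) = v x" if "x \<in> X" for x
    using someI[of "\<lambda>y. y \<in> X \<and> u y = u x" x] that uv unfolding \<sigma>_def by metis
  have \<sigma>_bij: "bij_betw \<sigma> (u ` X) (v ` X)"
    using \<sigma> uv by (auto simp: bij_betw_def inj_on_def image_image)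
  then have "card (u ` X) = card (v ` X)"
    by (rule bij_betw_same_card)
  then have "card (G - u ` X) = card (G - v ` X)"
    using assms(1-3) by (simp add: card_Diff_subset finite_subset)
  then obtain \<tau> where \<tau>: "bij_betw \<tau> (G - u ` X) (G - v ` X)"
    using assms(1) finite_same_card_bij[of "G - u ` X" "G - v ` X"] by auto
  define \<pi> where "\<pi> w = (if w \<in> u ` X then \<sigma> w else \<tau> w)" for w
  have "bij_betw \<pi> (u ` X \<union> (G - u ` X)) (v ` X \<union> (G - v ` X))"
  proof (rule bij_betw_combine)
    show "bij_betw \<pi> (u ` X) (v ` X)"
      using \<sigma>_bij by (simp add: \<pi>_def cong: bij_betw_cong)
    have "bij_betw \<pi> (G - u ` X) (G - v ` X) = bij_betw \<tau> (G - u ` X) (G - v ` X)"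
      by (rule bij_betw_cong) (simp add: \<pi>_def)
    then show "bij_betw \<pi> (G - u ` X) (G - v ` X)" using \<tau> by simp
  qed auto
  then have "bij_betw \<pi> G G"
    using assms(2,3) by (simp add: Un_absorb1)
  then show ?thesis
    using \<sigma> by (auto simp: \<pi>_def)
qed

section \<open>A set of points on which the automaton can be undone\<close>

text \<open>
  After the initial \<open>T\<close> symbols of a period, a symbol other than \<open>z\<close> recurs with
  period \<open>T\<close>, leaving no room for another run of length \<open>T\<close>.
\<close>

lemma (in marker_blocks) site_iff_dvd:
  assumes "T dvd L"
    and zero: "\<And>i. i mod L < T \<Longrightarrow> y i = z"
    and nonzero: "\<And>i. i mod T = T - 1 \<Longrightarrow> T \<le> i mod L \<Longrightarrow> y i \<noteq> z"
  shows "site y j \<longleftrightarrow> L dvd j"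
proof -
  obtain q where q: "L = T * q" using \<open>T dvd L\<close> ..
  have marker: "marker y i \<longleftrightarrow> L dvd i" for i
  proof
    assume "L dvd i"
    then obtain k where k: "i = L * k" ..
    have "(i - 1) mod L = L - 1"
      using T TL by (intro int_mod_pos_eq[of _ _ "k - 1"]) (auto simp: k algebra_simps)
    moreover have "(i - 1) mod T = T - 1"
      using T by (intro int_mod_pos_eq[of _ _ "q * k - 1"]) (auto simp: k q algebra_simps)
    ultimately have "y (i - 1) \<noteq> z"
      using TL by (intro nonzero) auto
    moreover have "y (i + t) = z" if "0 \<le> t" "t < T" for t
    proof (rule zero)
      have "(i + t) mod L = t"
        using that TL by (intro int_mod_pos_eq[of _ _ k]) (auto simp: k)
      then show "(i + t) mod L < T" using that by simp
    qed
    ultimately show "marker y i"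
      by (simp add: marker_def)
  next
    assume m: "marker y i"
    show "L dvd i"
    proof (rule ccontr)
      assume "\<not> L dvd i"
      define v where "v = i mod L"
      have i: "i = L * (i div L) + v"
        by (simp add: v_def)
      have "v \<noteq> 0"
        using \<open>\<not> L dvd i\<close> by (simp add: v_def dvd_eq_mod_eq_0)
      then have v: "0 < v" "v < L"
        using T TL pos_mod_sign[of L i] pos_mod_bound[of L i] unfolding v_def by linarith+
      have "(i - 1) mod L = v - 1"
        using i v by (intro int_mod_pos_eq[of _ _ "i div L"]) auto
      moreover have "\<not> (i - 1) mod L < T"
        using m zero by (auto simp: marker_def)
      ultimately have vT: "T < v" by simp
      \<comment> \<open>The run of the supposed marker meets the end of the cell that contains \<open>i\<close>.\<close>
      define t where "t = T - 1 - v mod T"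
      have t: "0 \<le> t" "t < T"
        using T pos_mod_sign[of T v] pos_mod_bound[of T v] unfolding t_def by linarith+
      have vt: "v + t = T * (v div T) + (T - 1)"
        using mult_div_mod_eq[of T v] unfolding t_def by linarith
      have "T * (v div T) < T * q"
        using v(2) mult_div_mod_eq[of T v] pos_mod_sign[of T v] T unfolding q by linarith
      then have "v div T + 1 \<le> q"
        using T by simp
      then have "T * (v div T + 1) \<le> T * q"
        using T by (intro mult_left_mono) auto
      then have "v + t < L"
        using vt by (simp add: q algebra_simps)
      then have "(i + t) mod L = v + t"
        using i v t by (intro int_mod_pos_eq[of _ _ "i div L"]) auto
      moreover have "(i + t) mod T = T - 1"
        using i vt T by (intro int_mod_pos_eq[of _ _ "q * (i div L) + v div T"]) (auto simp: q algebra_simps)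
      ultimately have "y (i + t) \<noteq> z"
        using vT t by (intro nonzero) auto
      then show False
        using m t by (simp add: marker_def)
    qed
  qed
  show ?thesis
  proof
    assume "L dvd j"
    moreover have "\<not> L dvd j + t" if "0 < t" "t < L" for t
      using that \<open>L dvd j\<close> by (auto simp: dvd_add_right_iff dest: zdvd_imp_le)
    ultimately show "site y j"
      by (auto simp: site_def marker)
  qed (simp add: site_def marker)
qed

text \<open>
  The period \<open>L\<close> is cut into cells of length \<open>T\<close>. The first cell is filled with
  \<open>z\<close>. Each other cell consists of \<open>r\<close> symbols \<open>z\<close>, a stretch of free symbols, \<open>r\<close>
  symbols \<open>z\<close>, and a final \<open>a\<close>. An automaton of radius \<open>r\<close> thus sees
  each \<open>a\<close> in isolation.
\<close>

definition skeleton :: "'a \<Rightarrow> 'a \<Rightarrow> int \<Rightarrow> int \<Rightarrow> int \<Rightarrow> (int \<Rightarrow> 'a) set" where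
  "skeleton z a r T L = {x. \<forall>i.
    (i mod L < T \<longrightarrow> x i = z) \<and>
    (i mod T < r \<longrightarrow> x i = z) \<and>
    (T - 1 - r \<le> i mod T \<and> i mod T < T - 1 \<longrightarrow> x i = z) \<and>
    (i mod T = T - 1 \<and> T \<le> i mod L \<longrightarrow> x i = a)}"

text \<open>
  The normalization that puts the sites of a skeleton point and those of its image at the same
  positions: \<open>f\<close> maps the background to itself and maps a single \<open>a\<close> to a finite pattern
  whose last symbol other than \<open>z\<close> stands where the \<open>a\<close> stood.
\<close>

locale normalized_ca =
  fixes f :: "(int \<Rightarrow> 'a::finite) \<Rightarrow> (int \<Rightarrow> 'a)" and z a :: 'a and r T L :: int
  assumes f: "has_radius r f" "surj f"
    and f_const: "\<And>i. f (\<lambda>_. z) i = z"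
    and f_spike: "f ((\<lambda>_. z)(0 := a)) 0 \<noteq> z" "\<And>i. 0 < i \<Longrightarrow> f ((\<lambda>_. z)(0 := a)) i = z"
    and rT: "2 * r + 1 \<le> T" and T_dvd: "T dvd L" and T_less: "T < L"
begin

abbreviation "X \<equiv> skeleton z a r T L"
abbreviation "e \<equiv> (\<lambda>_. z)(0 := a)"

lemma r_nonneg: "0 \<le> r"
  using f(1) by (rule has_radius_nonneg)

lemma T_pos: "0 < T"
  using r_nonneg rT by simp

sublocale marker_blocks z T L
  using T_pos T_less by unfold_locales

lemma a_ne: "a \<noteq> z"
  using f_const f_spike(1) by (auto simp: fun_upd_idem)

lemma
  assumes "x \<in> X"
  shows skeleton_zero: "i mod L < T \<Longrightarrow> x i = z"
    and skeleton_low: "i mod T < r \<Longrightarrow> x i = z"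
    and skeleton_high: "T - 1 - r \<le> i mod T \<Longrightarrow> i mod T < T - 1 \<Longrightarrow> x i = z"
    and skeleton_spike: "i mod T = T - 1 \<Longrightarrow> T \<le> i mod L \<Longrightarrow> x i = a"
  using assms by (simp_all add: skeleton_def)

text \<open>
  Around the start of a period, from the padding of the separator that ends the previous one up to the first free
  symbol, a skeleton point looks like the background with a single \<open>a\<close>.
\<close>

lemma skeleton_near_multiple:
  assumes x: "x \<in> X" and t: "- 1 - r \<le> t" "t < T + r"
  shows "x (L * k + t) = e (t + 1)"
proof -
  obtain q where q: "L = T * q" using T_dvd ..
  have r: "0 \<le> r" by (rule r_nonneg)
  consider "0 \<le> t" "t < T" | "T \<le> t" | "t = - 1" | "t < - 1" by linarith
  then show ?thesis
  proof cases
    case 1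
    then have "(L * k + t) mod L = t"
      using T_less by (intro int_mod_pos_eq[of _ _ k]) auto
    with 1 show ?thesis by (simp add: skeleton_zero[OF x])
  next
    case 2
    then have "(L * k + t) mod T = t - T"
      using t rT r by (intro int_mod_pos_eq[of _ _ "q * k + 1"]) (auto simp: q algebra_simps)
    with 2 t T_pos show ?thesis by (simp add: skeleton_low[OF x])
  next
    case 3
    have "(L * k + t) mod T = T - 1"
      using T_pos 3 by (intro int_mod_pos_eq[of _ _ "q * k - 1"]) (auto simp: q algebra_simps)
    moreover have "(L * k + t) mod L = L - 1"
      using T_pos T_less 3 by (intro int_mod_pos_eq[of _ _ "k - 1"]) (auto simp: algebra_simps)
    ultimately show ?thesis
      using T_less 3 by (simp add: skeleton_spike[OF x])
  next
    case 4
    have "(L * k + t) mod T = T + t"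
      using T_pos t rT r 4 by (intro int_mod_pos_eq[of _ _ "q * k - 1"]) (auto simp: q algebra_simps)
    with 4 t show ?thesis by (simp add: skeleton_high[OF x])
  qed
qed

lemma image_zero:
  assumes x: "x \<in> X" and i: "i mod L < T"
  shows "f x i = z"
proof -
  have i': "i = L * (i div L) + i mod L" "0 \<le> i mod L"
    using T_pos T_less by auto
  have "f x i = f e (i mod L + 1)"
  proof (rule has_radiusD[OF f(1)])
    fix u :: int assume "\<bar>u\<bar> \<le> r"
    then have "x (L * (i div L) + (i mod L + u)) = e (i mod L + u + 1)"
      using i i'(2) by (intro skeleton_near_multiple[OF x]) auto
    then show "x (i + u) = e (i mod L + 1 + u)"
      using i'(1) by (simp add: algebra_simps)
  qed
  then show ?thesis
    using f_spike(2) i'(2) by simp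
qed

lemma image_nonzero:
  assumes x: "x \<in> X" and i: "i mod T = T - 1" "T \<le> i mod L"
  shows "f x i \<noteq> z"
proof -
  have i': "i = T * (i div T) + (T - 1)"
    using mult_div_mod_eq[of T i] i by simp
  have r: "0 \<le> r" by (rule r_nonneg)
  have "f x i = f e 0"
  proof (rule has_radiusD[OF f(1)])
    fix u :: int assume u: "\<bar>u\<bar> \<le> r"
    consider "u = 0" | "u < 0" | "0 < u" by linarith
    then show "x (i + u) = e (0 + u)"
    proof cases
      case 1
      then show ?thesis using skeleton_spike[OF x i] by simp
    next
      case 2
      have "(i + u) mod T = T - 1 + u"
        using i' u 2 rT r by (intro int_mod_pos_eq[of _ _ "i div T"]) auto
      then show ?thesis
        using u 2 by (simp add: skeleton_high[OF x])
    next
      case 3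
      have "(i + u) mod T = u - 1"
        using i' u 3 rT r by (intro int_mod_pos_eq[of _ _ "i div T + 1"]) (auto simp: algebra_simps)
      then show ?thesis
        using u 3 by (simp add: skeleton_low[OF x])
    qed
  qed
  then show ?thesis
    using f_spike(1) by simp
qed

lemma site_skeleton: "x \<in> X \<Longrightarrow> site x j \<longleftrightarrow> L dvd j"
  using a_ne by (intro site_iff_dvd T_dvd) (auto simp: skeleton_zero skeleton_spike)

lemma site_image: "x \<in> X \<Longrightarrow> site (f x) j \<longleftrightarrow> L dvd j"
  by (intro site_iff_dvd T_dvd) (auto simp: image_zero image_nonzero)

text \<open>
  Between consecutive sites, \<open>f\<close> neither merges nor splits words. One direction is locality,
  as the surroundings of a period are prescribed. The other is pre-injectivity: the first cell of a
  period and that of the next one contain the agreeing margins of length \<open>2 * r\<close>.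
\<close>

lemma image_word_eq_iff:
  assumes x: "x \<in> X" and x': "x' \<in> X"
  shows "word L (f x) 0 = word L (f x') 0 \<longleftrightarrow> word L x 0 = word L x' 0"
proof
  have r: "0 \<le> r" by (rule r_nonneg)
  have outside: "x (L * k + t) = x' (L * k + t)" if "- 1 - r \<le> t" "t < T + r" for k t
    using that x x' by (simp add: skeleton_near_multiple)
  show "word L (f x) 0 = word L (f x') 0" if eq: "word L x 0 = word L x' 0"
    unfolding word_eq_iff
  proof (intro allI impI)
    fix t assume t: "0 \<le> t \<and> t < L"
    have "f x t = f x' t"
    proof (rule has_radiusD[OF f(1)])
      fix u :: int assume u: "\<bar>u\<bar> \<le> r"
      consider "t + u < 0" | "0 \<le> t + u" "t + u < L" | "L \<le> t + u" by linarith
      then show "x (t + u) = x' (t + u)"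
      proof cases
        case 1
        then show ?thesis using outside[of "t + u" 0] t u T_pos r by simp
      next
        case 2
        then show ?thesis using eq by (simp add: word_eq_iff)
      next
        case 3
        then show ?thesis using outside[of "t + u - L" 1] t u T_pos r by simp
      qed
    qed
    then show "f x (0 + t) = f x' (0 + t)" by simp
  qed
  show "word L x 0 = word L x' 0" if eq: "word L (f x) 0 = word L (f x') 0"
    unfolding word_eq_iff
  proof (intro allI impI)
    fix t assume t: "0 \<le> t \<and> t < L"
    show "x (0 + t) = x' (0 + t)"
    proof (cases "t < 2 * r")
      case True
      then show ?thesis using outside[of t 0] t rT r by simp
    next
      case False
      have "x t = x' t"
      proof (rule no_diamond[OF f, of "2 * r" x x' L])
        show "x i = x' i" if "2 * r - 2 * r \<le> i" "i < 2 * r" for i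
          using outside[of i 0] that rT r by simp
        show "x i = x' i" if "L \<le> i" "i < L + 2 * r" for i
          using outside[of "i - L" 1] that rT r by simp
        show "f x i = f x' i" if i: "2 * r - r \<le> i" "i < L + r" for i
        proof (cases "i < L")
          case True
          then show ?thesis using eq i r by (simp add: word_eq_iff)
        next
          case False
          then have "i mod L = i - L"
            using i rT r T_less by (intro int_mod_pos_eq[of _ _ 1]) auto
          then show ?thesis
            using i rT r x x' by (simp add: image_zero)
        qed
      qed (use False t in auto)
      then show ?thesis by simp
    qed
  qed
qed

lemma skeleton_translate:
  assumes "x \<in> X"
  shows "(\<lambda>i. x (L * k + i)) \<in> X"
proof -
  obtain q where q: "L = T * q" using T_dvd ..
  have "(L * k + i) mod T = i mod T" for i
    by (simp add: q mult.assoc)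
  then show ?thesis
    using assms by (simp add: skeleton_def)
qed

text \<open>
  The sites of \<open>f x\<close> are those of \<open>x\<close>, and the word of \<open>f x\<close> at a site
  determines that of \<open>x\<close>; the recoding sends the one to the other.
\<close>

lemma left_inverse_on_skeleton:
  "\<exists>\<phi>. invertible_ca \<phi> \<and> (\<forall>x\<in>X. \<phi> (f x) = x)"
proof -
  have "finite site_words"
    by (rule finite_subset[OF _ finite_words[of "nat L"]]) (auto dest: site_words_same_length)
  moreover have "(\<lambda>x. word L (f x) 0) ` X \<subseteq> site_words"
    by (auto simp: site_words_def site_image intro!: exI[of _ 0])
  moreover have "(\<lambda>x. word L x 0) ` X \<subseteq> site_words"
    by (auto simp: site_words_def site_skeleton intro!: exI[of _ 0])
  ultimately obtain \<pi> where \<pi>: "bij_betw \<pi> site_words site_words"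
      "\<And>x. x \<in> X \<Longrightarrow> \<pi> (word L (f x) 0) = word L x 0"
    using extend_matching[of site_words "\<lambda>x. word L (f x) 0" X "\<lambda>x. word L x 0"] image_word_eq_iff
    by blast
  have "recode \<pi> (f x) = x" if x: "x \<in> X" for x
  proof
    fix i
    define k where "k = i div L"
    define t where "t = i mod L"
    have i: "i = L * k + t" and t: "0 \<le> t" "t < L"
      using T_pos T_less by (simp_all add: k_def t_def)
    define x' where "x' = (\<lambda>i. x (L * k + i))"
    have "f x (L * k + s) = f x' (0 + s)" for s
      by (rule has_radiusD[OF f(1)]) (simp add: x'_def algebra_simps)
    then have "word L (f x) (L * k) = word L (f x') 0"
      unfolding word_eq_iff by blast
    then have "\<pi> (word L (f x) (L * k)) = word L x' 0"
      using \<pi>(2) skeleton_translate[OF x, of k] by (simp add: x'_def)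
    moreover have "recode \<pi> (f x) i = \<pi> (word L (f x) (L * k)) ! nat t"
      unfolding i using t x by (intro recode_inside) (simp_all add: site_image)
    ultimately show "recode \<pi> (f x) i = x i"
      using t by (simp add: word_nth x'_def i)
  qed
  then show ?thesis
    using invertible_recode[OF \<pi>(1)] by blast
qed

end

section \<open>Counting periodic points\<close>

lemma shift_funpow: "(shift ^^ k) x = (\<lambda>i. x (i + int k))"
  by (induction k) (auto simp: shift_def algebra_simps)

lemma period_points_shift: "period_points k shift = {x. \<forall>i. x (i + int k) = x i}"
  by (auto simp: period_points_def shift_funpow fun_eq_iff)

lemma periodic_mod:
  fixes x :: "int \<Rightarrow> 'a"
  assumes "x \<in> period_points k shift"
  shows "x (i mod int k) = x i"
proof -
  have per: "x (i + int k) = x i" for i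
    using assms by (simp add: period_points_shift)
  have up: "x (i + int m * int k) = x i" for i and m :: nat
  proof (induction m)
    case (Suc m)
    then show ?case using per[of "i + int m * int k"] by (simp add: algebra_simps)
  qed simp
  define m where "m = i div int k"
  have i: "i = i mod int k + m * int k" by (simp add: m_def)
  show ?thesis
  proof (cases "0 \<le> m")
    case True
    then show ?thesis using up[of "i mod int k" "nat m"] i by simp
  next
    case False
    have "i mod int k = i - m * int k" using i by linarith
    then show ?thesis using up[of i "nat (- m)"] False by simp
  qed
qed

lemma finite_period_points:
  assumes "0 < k"
  shows "finite (period_points k (shift :: (int \<Rightarrow> 'a::finite) \<Rightarrow> _))"
proof (rule inj_on_finite[OF _ _ finite_words[of k]])
  show "inj_on (\<lambda>x. word (int k) x 0) (period_points k (shift :: (int \<Rightarrow> 'a) \<Rightarrow> _))"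
  proof (rule inj_onI, rule ext)
    fix x y :: "int \<Rightarrow> 'a" and i
    assume xy: "x \<in> period_points k shift" "y \<in> period_points k shift"
      and "word (int k) x 0 = word (int k) y 0"
    then have "x (0 + i mod int k) = y (0 + i mod int k)"
      unfolding word_eq_iff using assms by (meson of_nat_0_less_iff pos_mod_bound pos_mod_sign)
    then show "x i = y i"
      using periodic_mod[OF xy(1)] periodic_mod[OF xy(2)] by simp
  qed
qed auto

text \<open>
  A skeleton point of period \<open>k * L\<close> has \<open>K * p\<close> free symbols in each of its \<open>k\<close>
  periods. The map \<open>h\<close> enumerates these positions by period, cell, and place in
  the cell.
\<close>

lemma card_skeleton_ge:
  fixes z a :: "'a::finite" and k K p :: nat and r :: int
  assumes r: "0 \<le> r" and k: "0 < k" and T: "T = int p + 2 * r + 1" and L: "L = int (Suc K) * T"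
  shows "CARD('a) ^ (k * (K * p)) \<le> card (skeleton z a r T L \<inter> period_points (k * nat L) shift)"
proof -
  define R where "R = int k * L"
  have T0: "0 < T" using r T by simp
  have L0: "0 < L" using T0 by (simp add: L)
  define D where "D = {i. 0 \<le> i \<and> i < R \<and> T \<le> i mod L \<and> r \<le> i mod T \<and> i mod T < T - 1 - r}"
  define h where "h = (\<lambda>(c, b, t). c * L + ((b + 1) * T + (r + t)))"
  define B where "B = {0..<int k} \<times> {0..<int K} \<times> {0..<int p}"
  have in_block: "0 \<le> (b + 1) * T + (r + t) \<and> T \<le> (b + 1) * T + (r + t) \<and> (b + 1) * T + (r + t) < L"
    if "0 \<le> b" "b < int K" "0 \<le> t" "t < int p" for b t
  proof -
    have "T * 1 \<le> T * (b + 1)" "T * (b + 1) \<le> T * int K"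
      using T0 that by (auto intro!: mult_left_mono)
    then show ?thesis
      using that r T0 T by (simp add: L algebra_simps)
  qed
  have hmod: "h (c, b, t) mod L = (b + 1) * T + (r + t)" "h (c, b, t) div L = c"
      "h (c, b, t) mod T = r + t" "((b + 1) * T + (r + t)) div T = b + 1"
    if "0 \<le> b" "b < int K" "0 \<le> t" "t < int p" for c b t
  proof -
    show "h (c, b, t) mod L = (b + 1) * T + (r + t)"
      using in_block[OF that] by (intro int_mod_pos_eq[of _ _ c]) (auto simp: h_def)
    show "h (c, b, t) div L = c"
      using in_block[OF that] by (intro int_div_pos_eq[of _ _ _ "(b + 1) * T + (r + t)"]) (auto simp: h_def)
    show "h (c, b, t) mod T = r + t"
      using that r T by (intro int_mod_pos_eq[of _ _ "c * int (Suc K) + (b + 1)"]) (auto simp: h_def L algebra_simps)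
    show "((b + 1) * T + (r + t)) div T = b + 1"
      using that r T by (intro int_div_pos_eq[of _ _ _ "r + t"]) auto
  qed
  have "inj_on h B"
    by (rule inj_on_inverseI[where g = "\<lambda>i. (i div L, i mod L div T - 1, i mod T - r)"])
      (auto simp: B_def hmod)
  moreover have "h ` B \<subseteq> D"
  proof
    fix i assume "i \<in> h ` B"
    then obtain c b t where i: "i = h (c, b, t)" and
      cbt: "0 \<le> c" "c < int k" "0 \<le> b" "b < int K" "0 \<le> t" "t < int p"
      by (auto simp: B_def)
    have "0 * L \<le> c * L" "(c + 1) * L \<le> int k * L"
      using cbt L0 by (auto intro!: mult_right_mono)
    then have "0 \<le> i" "i < R"
      using in_block[OF cbt(3-6)] by (auto simp: i h_def R_def algebra_simps)
    moreover have "r + t < T - 1 - r"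
      using cbt T by simp
    ultimately show "i \<in> D"
      using in_block[OF cbt(3-6)] cbt by (simp add: D_def i hmod)
  qed
  moreover have "finite D"
    by (rule finite_subset[of _ "{0..<R}"]) (auto simp: D_def)
  ultimately have "card B \<le> card D"
    by (rule card_inj_on_le)
  then have cD: "k * (K * p) \<le> card D"
    by (simp add: B_def card_cartesian_product)
  define x where "x g i = (if i mod L < T then z else if i mod T = T - 1 then a
      else if r \<le> i mod T \<and> i mod T < T - 1 - r then g (i mod R) else z)" for g i
  have "x g \<in> skeleton z a r T L" for g
    using r T by (auto simp: skeleton_def x_def)
  moreover have "x g \<in> period_points (k * nat L) shift" for g
  proof -
    have "(i + R) mod L = i mod L" "(i + R) mod T = i mod T" "(i + R) mod R = i mod R" for i
    proof -
      have "R = (int k * int (Suc K)) * T" by (simp add: R_def L)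
      then show "(i + R) mod T = i mod T" by (simp del: of_nat_Suc)
    qed (simp_all add: R_def)
    moreover have "int (k * nat L) = R" using L0 by (simp add: R_def)
    ultimately show ?thesis
      unfolding period_points_shift x_def by simp
  qed
  moreover have "inj_on x (PiE D (\<lambda>_. UNIV))"
  proof (rule inj_onI, rule ext)
    fix g g' i assume g: "g \<in> PiE D (\<lambda>_. UNIV)" "g' \<in> PiE D (\<lambda>_. UNIV)" and eq: "x g = x g'"
    show "g i = g' i"
    proof (cases "i \<in> D")
      case True
      then have "x g i = g i" for g
        using r by (auto simp: D_def x_def)
      then show ?thesis using eq by metis
    next
      case False
      then show ?thesis using g by (auto simp: PiE_def extensional_def)
    qed
  qed
  moreover have "finite (skeleton z a r T L \<inter> period_points (k * nat L) shift)"
    using k L0 by (intro finite_Int disjI2 finite_period_points) simp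
  ultimately have "card (PiE D (\<lambda>_. UNIV :: 'a set)) \<le> card (skeleton z a r T L \<inter> period_points (k * nat L) shift)"
    by (intro card_inj_on_le[of x]) auto
  moreover have "CARD('a) ^ (k * (K * p)) \<le> CARD('a) ^ card D"
    using cD by (intro power_increasing) (simp_all add: Suc_leI)
  ultimately show ?thesis
    using \<open>finite D\<close> by (simp add: card_PiE)
qed

text \<open>
  The lower bound for the \<open>(k * L)\<close>-th root is the same for all \<open>k\<close>, and the multiples
  of \<open>L\<close> form a subsequence.
\<close>

lemma nu_ge:
  fixes N L q :: nat
  assumes "1 \<le> N" "0 < L"
    and bound: "\<And>k. 0 < k \<Longrightarrow> N ^ (k * q) \<le> card {x \<in> period_points (k * L) S. periodic_under g x}"
  shows "ereal (real N powr (real q / real L)) \<le> nu g S"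
proof -
  define s where "s k = Suc k * L" for k
  have "real N powr (real q / real L) \<le> nu_k (s k) g S" for k
  proof -
    have pos: "0 < s k" using \<open>0 < L\<close> by (simp add: s_def)
    have "real q / real L = real (Suc k * q) * (1 / real (s k))"
      using \<open>0 < L\<close> by (simp add: s_def del: of_nat_Suc mult_Suc)
    then have "real N powr (real q / real L) = (real N powr real (Suc k * q)) powr (1 / real (s k))"
      by (simp only: powr_powr)
    also have "\<dots> = (real N ^ (Suc k * q)) powr (1 / real (s k))"
      using assms(1) by (subst powr_realpow) auto
    also have "\<dots> = root (s k) (real N ^ (Suc k * q))"
      using pos assms(1) by (subst root_powr_inverse) auto
    also have "\<dots> \<le> nu_k (s k) g S"
      unfolding nu_k_def using pos bound[of "Suc k"]
      by (simp add: s_def flip: of_nat_power del: power_Suc mult_Suc)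
    finally show ?thesis .
  qed
  then have "ereal (real N powr (real q / real L)) \<le> limsup ((\<lambda>k. ereal (nu_k k g S)) \<circ> s)"
    by (intro le_Limsup) auto
  also have "\<dots> \<le> nu g S"
    unfolding nu_def using \<open>0 < L\<close> by (intro limsup_subseq_mono) (auto simp: s_def strict_mono_def)
  finally show ?thesis .
qed

section \<open>Normalization and conclusion\<close>

text \<open>
  Exchanging two symbols makes the background a fixed point. The image of a single \<open>a\<close>
  is then not the background, by pre-injectivity, and differs from it in finitely many places
  only, so a power of the shift moves the last of them to position \<open>0\<close>.
\<close>

lemma normalize_ca:
  fixes f :: "(int \<Rightarrow> 'a::finite) \<Rightarrow> (int \<Rightarrow> 'a)"
  assumes f: "has_radius r f" "surj f" and "a \<noteq> z"
  obtains \<tau> r' where "invertible_ca \<tau>" "has_radius r' (\<tau> \<circ> f)"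
    "\<And>i. \<tau> (f (\<lambda>_. z)) i = z"
    "\<tau> (f ((\<lambda>_. z)(0 := a))) 0 \<noteq> z" "\<And>i. 0 < i \<Longrightarrow> \<tau> (f ((\<lambda>_. z)(0 := a))) i = z"
proof -
  define e where "e = (\<lambda>_. z)(0 :: int := a)"
  define c where "c = f (\<lambda>_. z) 0"
  have fz: "f (\<lambda>_. z) i = c" for i
    unfolding c_def by (rule has_radiusD[OF f(1)]) simp
  define E where "E = {i. f e i \<noteq> c}"
  have "f e i = c" if "\<not> \<bar>i\<bar> \<le> r" for i
  proof -
    have "f e i = f (\<lambda>_. z) i"
      by (rule has_radiusD[OF f(1)]) (use that in \<open>auto simp: e_def\<close>)
    then show ?thesis by (simp add: fz)
  qed
  then have "\<bar>i\<bar> \<le> r" if "i \<in> E" for i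
    using that unfolding E_def by blast
  then have "E \<subseteq> {-r..r}"
    by (force simp: abs_le_iff)
  then have fin: "finite E"
    by (rule finite_subset) simp
  have "e \<noteq> (\<lambda>_. z)"
    using \<open>a \<noteq> z\<close> by (metis e_def fun_upd_same)
  then have "f e \<noteq> f (\<lambda>_. z)"
    using surj_imp_preinjective[OF f, of e "\<lambda>_. z" 0 1] by (force simp: e_def)
  then have "E \<noteq> {}"
    by (auto simp: E_def fz fun_eq_iff)
  define d where "d = Max E"
  have d: "f e d \<noteq> c" "\<And>i. d < i \<Longrightarrow> f e i = c"
    using Max_in[OF fin \<open>E \<noteq> {}\<close>] Max_ge[OF fin] unfolding d_def E_def by force+
  define \<tau> where "\<tau> y i = transpose z c (y (i + d))" for y i
  have \<tau>: "has_radius \<bar>d\<bar> \<tau>"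
    by (auto simp: has_radius_def \<tau>_def)
  have "bij \<tau>"
  proof (rule o_bij)
    show "(\<lambda>y i. transpose z c (y (i - d))) \<circ> \<tau> = id" "\<tau> \<circ> (\<lambda>y i. transpose z c (y (i - d))) = id"
      by (auto simp: \<tau>_def fun_eq_iff)
  qed
  with \<tau> have "invertible_ca \<tau>"
    unfolding invertible_ca_def cellular_automaton_iff_has_radius by blast
  moreover have "has_radius (r + \<bar>d\<bar>) (\<tau> \<circ> f)"
    by (rule has_radius_comp[OF f(1) \<tau>])
  moreover have "transpose z c v = z \<longleftrightarrow> v = c" for v
    by (auto simp: transpose_def)
  ultimately show ?thesis
    using d fz by (intro that[of \<tau> "r + \<bar>d\<bar>"]) (auto simp: \<tau>_def e_def[symmetric])
qed

theorem theorem3p2: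
  fixes f :: "(int \<Rightarrow> 'a::finite) \<Rightarrow> (int \<Rightarrow> 'a)" and \<epsilon> :: real
  assumes "cellular_automaton f" and "surj f" and "\<epsilon> > 0"
  shows "\<exists>\<phi> :: (int \<Rightarrow> 'a) \<Rightarrow> (int \<Rightarrow> 'a).
    invertible_ca \<phi> \<and> nu (\<phi> \<circ> f) shift > ereal (real CARD('a) - \<epsilon>)"
proof -
  obtain r\<^sub>0 where r\<^sub>0: "has_radius r\<^sub>0 f"
    using \<open>cellular_automaton f\<close> by (auto simp: cellular_automaton_iff_has_radius)
  have N: "1 \<le> CARD('a)" by (simp add: Suc_leI)
  have "\<exists>\<phi>. invertible_ca \<phi> \<and> (\<exists>n. \<exists>L>0. real CARD('a) - \<epsilon> < real CARD('a) powr (real n / real L) \<and>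
      (\<forall>k>0. CARD('a) ^ (k * n) \<le> card {x \<in> period_points (k * L) shift. periodic_under (\<phi> \<circ> f) x}))"
    \<comment> \<open>The skeleton needs two symbols; the full shift on one symbol is a single point.\<close>
  proof (cases "\<exists>a z :: 'a. a \<noteq> z")
    case False
    then have one: "x = y" for x y :: "int \<Rightarrow> 'a"
      by (auto simp: fun_eq_iff)
    have "has_radius 0 (id :: (int \<Rightarrow> 'a) \<Rightarrow> _)"
      by (simp add: has_radius_def)
    then have "invertible_ca (id :: (int \<Rightarrow> 'a) \<Rightarrow> _)"
      by (auto simp: invertible_ca_def cellular_automaton_iff_has_radius)
    moreover have "CARD('a) = 1"
      using False by (metis (full_types) UNIV_eq_I card_1_singleton_iff is_singletonI' is_singleton_altdef UNIV_I empty_not_UNIV)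
    moreover have "1 \<le> card {x \<in> period_points k (shift :: (int \<Rightarrow> 'a) \<Rightarrow> _). periodic_under (id \<circ> f) x}"
      if "0 < k" for k
    proof -
      have "{x \<in> period_points k (shift :: (int \<Rightarrow> 'a) \<Rightarrow> _). periodic_under (id \<circ> f) x} = {undefined}"
        using one by (auto simp: period_points_def periodic_under_def)
      then show ?thesis by simp
    qed
    ultimately show ?thesis
      using \<open>\<epsilon> > 0\<close> by (intro exI[of _ id] conjI exI[of _ 0] exI[of _ 1]) auto
  next
    case True
    then obtain a z :: 'a where "a \<noteq> z" by blast
    then obtain \<tau> r where \<tau>: "invertible_ca \<tau>" "has_radius r (\<tau> \<circ> f)"
      "\<And>i. \<tau> (f (\<lambda>_. z)) i = z"
      "\<tau> (f ((\<lambda>_. z)(0 := a))) 0 \<noteq> z" "\<And>i. 0 < i \<Longrightarrow> \<tau> (f ((\<lambda>_. z)(0 := a))) i = z"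
      using normalize_ca[OF r\<^sub>0 \<open>surj f\<close>] by metis
    \<comment> \<open>With \<open>n\<close> cells per period and \<open>n\<close> free symbols per cell, the
      proportion of free symbols tends to \<open>1\<close>.\<close>
    define N where "N = real CARD('a)"
    define R where "R = real_of_int r"
    have "N > 0" by (simp add: N_def)
    have "((\<lambda>n::nat. real n * real n / ((real n + 1) * (real n + 2 * R + 1))) \<longlongrightarrow> 1) sequentially"
      by real_asymp
    then have "((\<lambda>n::nat. N powr (real n * real n / ((real n + 1) * (real n + 2 * R + 1)))) \<longlongrightarrow> N powr 1) sequentially"
      using \<open>N > 0\<close> by (intro tendsto_intros) auto
    then have "eventually (\<lambda>n::nat. N - \<epsilon> < N powr (real n * real n / ((real n + 1) * (real n + 2 * R + 1)))) sequentially"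
      using \<open>N > 0\<close> \<open>\<epsilon> > 0\<close> by (intro order_tendstoD) auto
    then obtain n where n: "1 \<le> n" "N - \<epsilon> < N powr (real n * real n / ((real n + 1) * (real n + 2 * R + 1)))"
      using eventually_happens[OF eventually_conj[OF _ eventually_ge_at_top[of "1::nat"]]] by auto
    define T where "T = int n + 2 * r + 1"
    define L where "L = int (Suc n) * T"
    have r: "0 \<le> r" using \<tau>(2) by (rule has_radius_nonneg)
    have T: "0 < T" using r by (simp add: T_def)
    have L: "0 < L" using T by (simp add: L_def)
    have "surj (\<tau> \<circ> f)"
      using \<tau>(1) \<open>surj f\<close> unfolding invertible_ca_def bij_def using comp_surj by blast
    moreover have "T < L"
      using T n by (simp add: L_def algebra_simps)
    ultimately interpret normalized_ca "\<tau> \<circ> f" z a r T L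
      using \<tau> by unfold_locales (auto simp: T_def L_def)
    obtain \<psi> where \<psi>: "invertible_ca \<psi>" "\<And>x. x \<in> X \<Longrightarrow> \<psi> ((\<tau> \<circ> f) x) = x"
      using left_inverse_on_skeleton by blast
    have "CARD('a) ^ (k * (n * n)) \<le> card {x \<in> period_points (k * nat L) shift. periodic_under (\<psi> \<circ> \<tau> \<circ> f) x}"
      if "0 < k" for k
    proof (rule order_trans[OF card_skeleton_ge[OF r that T_def L_def, of z a]], rule card_mono)
      show "finite {x \<in> period_points (k * nat L) shift. periodic_under (\<psi> \<circ> \<tau> \<circ> f) x}"
        using that L by (intro finite_subset[OF _ finite_period_points[of "k * nat L"]]) auto
      show "X \<inter> period_points (k * nat L) shift \<subseteq> {x \<in> period_points (k * nat L) shift. periodic_under (\<psi> \<circ> \<tau> \<circ> f) x}"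
        using \<psi>(2) by (auto simp: periodic_under_def intro!: exI[of _ 1])
    qed
    moreover have "real (nat L) = (real n + 1) * (real n + 2 * R + 1)"
      using L by (simp add: L_def T_def R_def algebra_simps)
    ultimately show ?thesis
      using n(2) L invertible_ca_comp[OF \<tau>(1) \<psi>(1)] unfolding N_def
      by (intro exI[of _ "\<psi> \<circ> \<tau>"] conjI exI[of _ "n * n"] exI[of _ "nat L"]) auto
  qed
  then obtain \<phi> n L where \<phi>: "invertible_ca \<phi>" and L: "0 < L"
    and close: "real CARD('a) - \<epsilon> < real CARD('a) powr (real n / real L)"
    and many: "\<And>k. 0 < k \<Longrightarrow>
      CARD('a) ^ (k * n) \<le> card {x \<in> period_points (k * L) shift. periodic_under (\<phi> \<circ> f) x}"
    by blast
  have "ereal (real CARD('a) - \<epsilon>) < ereal (real CARD('a) powr (real n / real L))"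
    using close by simp
  also have "\<dots> \<le> nu (\<phi> \<circ> f) shift"
    by (rule nu_ge[OF N L many])
  finally show ?thesis
    using \<phi> by blast
qed

end
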